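(* Suppose $P\in St_{2^k}$ is a standard tableau, where $k\ge 2$. Then $full_n^P=1$ for all $n\ge 1$ if and only if $P$ is degenerate.
   Context: $\mathcal{F}_{n,k}$ is the set of all fillings $F$ of the $k\times n$ rectangular array ($k$ rows, $n$ columns) with the integers $1,\dots,kn$, each used once, such that the elements in each column increase from bottom to top. $F(i,j)$ is the entry in the $i$-th row from the bottom and $j$-th column from the left. $St_{2^k}$ is the set of standard tableaux of shape $2^k$, i.e. elements of $\mathcal{F}_{2,k}$ whose entries also increase in each row from left to right. For a filling by distinct positive integers, $\mathrm{red}$ replaces the $i$-th smallest entry by $i$. For $P\in\mathcal{F}_{2,k}$, $F\in\mathcal{F}_{n,k}$ has a $P$-match starting at position $i$ ($1\le i\le n-1$) if the reduction of the $k\times 2$ filling formed by columns $i,i+1$ of $F$ equals $P$. $full_n^P$ is the number of $F\in\mathcal{F}_{n,k}$ having $P$-matches starting at every position $1,\dots,n-1$, with $full_1^P=1$ by convention. $P\in St_{2^k}$ is degenerate if for each $1\le i<k$ at least one of $P(i,1)+1=P(i+1,1)$ or $P(i,2)+1=P(i+1,2)$ holds. *)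

theory Defs
  imports Complex_Main "HOL-Library.FuncSet"
begin

text \<open>The cell \<open>(i, j)\<close> is in the \<open>i\<close>-th row from the bottom and the \<open>j\<close>-th column from the
  left, both counted from 1.\<close>

definition cells :: "nat \<Rightarrow> nat \<Rightarrow> (nat \<times> nat) set" where
  "cells k n = {1..k} \<times> {1..n}"

text \<open>Fillings are extensional on the cells of the array, so that distinct elements of \<open>fillings\<close>
  are distinct arrays and cardinalities count arrays.\<close>

definition fillings :: "nat \<Rightarrow> nat \<Rightarrow> (nat \<times> nat \<Rightarrow> nat) set" where
  "fillings n k = {F \<in> extensional (cells k n).
     bij_betw F (cells k n) {1..k * n} \<and>
     (\<forall>j\<in>{1..n}. strict_mono_on {1..k} (\<lambda>i. F (i, j)))}"

definition standard_tableaux2 :: "nat \<Rightarrow> (nat \<times> nat \<Rightarrow> nat) set" where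
  "standard_tableaux2 k = {P \<in> fillings 2 k. \<forall>i\<in>{1..k}. strict_mono_on {1..2} (\<lambda>j. P (i, j))}"

text \<open>The number of entries not exceeding a given entry is its rank, as the entries of the array
  are distinct.\<close>

definition reduction :: "nat \<Rightarrow> nat \<Rightarrow> (nat \<times> nat \<Rightarrow> nat) \<Rightarrow> (nat \<times> nat \<Rightarrow> nat)" where
  "reduction k n F = (\<lambda>c\<in>cells k n. card {d \<in> cells k n. F d \<le> F c})"

definition column_pair :: "nat \<Rightarrow> (nat \<times> nat \<Rightarrow> nat) \<Rightarrow> nat \<Rightarrow> (nat \<times> nat \<Rightarrow> nat)" where
  "column_pair k F i = (\<lambda>(r, c)\<in>cells k 2. if c = 1 then F (r, i) else F (r, i + 1))"

definition match_at :: "nat \<Rightarrow> (nat \<times> nat \<Rightarrow> nat) \<Rightarrow> (nat \<times> nat \<Rightarrow> nat) \<Rightarrow> nat \<Rightarrow> bool" where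
  "match_at k P F i \<longleftrightarrow> reduction k 2 (column_pair k F i) = P"

definition full :: "nat \<Rightarrow> (nat \<times> nat \<Rightarrow> nat) \<Rightarrow> nat \<Rightarrow> nat" where
  "full k P n = (if n = 1 then 1
     else card {F \<in> fillings n k. \<forall>i\<in>{1..n - 1}. match_at k P F i})"

definition degenerate :: "nat \<Rightarrow> (nat \<times> nat \<Rightarrow> nat) \<Rightarrow> bool" where
  "degenerate k P \<longleftrightarrow>
     (\<forall>i. 1 \<le> i \<and> i < k \<longrightarrow> P (i, 1) + 1 = P (i + 1, 1) \<or> P (i, 2) + 1 = P (i + 1, 2))"

end

theory Submission
  imports Defs "HOL-Combinatorics.Transposition"
begin

text \<open>
  A filling with \<open>P\<close>-matches everywhere is a linear extension of the relation that the columns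
  increase upwards and that any two neighbouring columns compare as the two columns of \<open>P\<close> do.
  So the question is when this relation has exactly one linear extension.

  \<^item> At least one always exists (\<open>matching_fillings_nonempty\<close>). Real labels are chosen column
    by column: the increasing map that sends the first column of \<open>P\<close> to the labels of the last
    column constructed extends to an increasing map on all entries of \<open>P\<close>, and its values on the
    second column of \<open>P\<close> label the next column. Ranks turn the labels into a filling.

  \<^item> Exchanging consecutive entries \<open>m\<close>, \<open>m + 1\<close> that lie in columns at distance at least 2
    leaves all matches intact (\<open>swap_in_matching_fillings\<close>). Conversely, if no such pair exists
    then every matching filling has to agree on each consecutive pair, and there is only one
    (\<open>matching_filling_unique\<close>).

  \<^item> If \<open>P\<close> is not degenerate at row \<open>r\<close>, then in every matching filling with three columns both
    the first and the third column have an entry between the entries of the middle column in rows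
    \<open>r\<close> and \<open>r + 1\<close>. All entries in that range lie in these two columns, so somewhere two
    consecutive ones can be exchanged (\<open>not_degenerate_not_unique\<close>).

  \<^item> If \<open>P\<close> is degenerate, let \<open>x\<close> and \<open>y\<close> be cells in columns \<open>i\<close> and \<open>j\<close> with \<open>i + 2 \<le> j\<close> that
    hold consecutive entries. In each column strictly between, the common value falls between two
    successive rows \<open>r\<close> and \<open>r + 1\<close>. In column \<open>i + 1\<close> the entry of \<open>x\<close> shows that
    \<open>P(r, 2)\<close> and \<open>P(r + 1, 2)\<close> are not consecutive; degeneracy makes \<open>P(r, 1)\<close> and
    \<open>P(r + 1, 1)\<close> consecutive, which puts \<open>P(r + 1, 1)\<close> into the corresponding gap for the
    next column. The property thus travels to column \<open>j - 1\<close>, where the entry of \<open>y\<close>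
    contradicts it (\<open>degenerate_consecutive_near\<close>).
\<close>

section \<open>Ranks\<close>

text \<open>The position of \<open>c\<close>, counted from 1, when \<open>A\<close> is ordered by \<open>f\<close>. The codomain is an arbitrary
  linear order, so that labels may be real numbers; on the cells of an array and with natural
  labels this is the reduction of the array.\<close>

definition rank :: "'a set \<Rightarrow> ('a \<Rightarrow> 'b::linorder) \<Rightarrow> 'a \<Rightarrow> nat" where
  "rank A f c = card {d \<in> A. f d \<le> f c}"

lemma rank_less_iff:
  assumes "finite A" "c \<in> A" "d \<in> A"
  shows "rank A f c < rank A f d \<longleftrightarrow> f c < f d"
proof
  assume "f c < f d"
  then have "{e \<in> A. f e \<le> f c} \<subset> {e \<in> A. f e \<le> f d}"
    using assms(3) order.trans[of _ "f c" "f d"] by (force simp: not_le)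
  then show "rank A f c < rank A f d"
    unfolding rank_def by (intro psubset_card_mono) (use assms(1) in auto)
next
  assume less: "rank A f c < rank A f d"
  show "f c < f d"
  proof (rule ccontr)
    assume "\<not> f c < f d"
    then have "{e \<in> A. f e \<le> f d} \<subseteq> {e \<in> A. f e \<le> f c}"
      by auto
    then have "rank A f d \<le> rank A f c"
      unfolding rank_def by (intro card_mono) (use assms(1) in auto)
    with less show False by simp
  qed
qed

lemma rank_cong:
  assumes "c \<in> A" "\<And>d. d \<in> A \<Longrightarrow> f c < f d \<longleftrightarrow> g c < g d"
  shows "rank A f c = rank A g c"
proof -
  have "{d \<in> A. f d \<le> f c} = {d \<in> A. g d \<le> g c}"
    using assms(2) by (auto simp: not_less[symmetric])
  then show ?thesis by (simp add: rank_def)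
qed

lemma rank_bij_betw:
  assumes "finite A" "inj_on f A"
  shows "bij_betw (rank A f) A {1..card A}"
proof -
  have inj: "inj_on (rank A f) A"
  proof (rule inj_onI)
    fix c d
    assume c: "c \<in> A" and d: "d \<in> A" and eq: "rank A f c = rank A f d"
    have "\<not> f c < f d" "\<not> f d < f c"
      using rank_less_iff[OF assms(1) c d, of f] rank_less_iff[OF assms(1) d c, of f] eq by auto
    then have "f c = f d" by simp
    then show "c = d" using assms(2) c d by (simp add: inj_on_def)
  qed
  have "rank A f ` A \<subseteq> {1..card A}"
  proof
    fix m
    assume "m \<in> rank A f ` A"
    then obtain c where c: "c \<in> A" "m = rank A f c" by blast
    have "card {d \<in> A. f d \<le> f c} \<le> card A"
      by (intro card_mono) (use assms(1) in auto)
    moreover have "card {d \<in> A. f d \<le> f c} > 0"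
      using c(1) assms(1) by (auto simp: card_gt_0_iff)
    ultimately show "m \<in> {1..card A}" by (simp add: c(2) rank_def)
  qed
  moreover have "card (rank A f ` A) = card {1..card A}"
    using card_image[OF inj] by simp
  ultimately have "rank A f ` A = {1..card A}"
    by (intro card_subset_eq) auto
  with inj show ?thesis by (simp add: bij_betw_def)
qed

lemma rank_eq_self:
  fixes f :: "'a \<Rightarrow> nat"
  assumes "bij_betw f A {1..N}" "c \<in> A"
  shows "rank A f c = f c"
proof -
  have inj: "inj_on f A" and img: "f ` A = {1..N}"
    using assms(1) by (auto simp: bij_betw_def)
  have "f c \<in> {1..N}" using img assms(2) by blast
  have "f ` {d \<in> A. f d \<le> f c} = {1..f c}"
  proof
    show "f ` {d \<in> A. f d \<le> f c} \<subseteq> {1..f c}" using img by auto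
    show "{1..f c} \<subseteq> f ` {d \<in> A. f d \<le> f c}"
    proof
      fix m
      assume m: "m \<in> {1..f c}"
      then have "m \<in> f ` A" using \<open>f c \<in> {1..N}\<close> img by simp
      then show "m \<in> f ` {d \<in> A. f d \<le> f c}" using m by auto
    qed
  qed
  moreover have "inj_on f {d \<in> A. f d \<le> f c}"
    using inj by (rule inj_on_subset) auto
  ultimately show ?thesis
    unfolding rank_def using card_image by fastforce
qed

section \<open>Fillings with matches at every position\<close>

text \<open>The fillings with \<open>n\<close> columns that \<open>full k P n\<close> counts for \<open>n \<noteq> 1\<close>; for \<open>n \<le> 1\<close> the matching
  condition is empty.\<close>

definition matching_fillings :: "nat \<Rightarrow> (nat \<times> nat \<Rightarrow> nat) \<Rightarrow> nat \<Rightarrow> (nat \<times> nat \<Rightarrow> nat) set" where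
  "matching_fillings k P n = {F \<in> fillings n k. \<forall>i\<in>{1..n - 1}. match_at k P F i}"

lemma finite_cells: "finite (cells k n)"
  by (simp add: cells_def)

lemma mem_cells: "(i, j) \<in> cells k n \<longleftrightarrow> 1 \<le> i \<and> i \<le> k \<and> 1 \<le> j \<and> j \<le> n"
  by (auto simp: cells_def)

lemma filling_eqD:
  assumes "F \<in> fillings n k" "c \<in> cells k n" "d \<in> cells k n" "F c = F d"
  shows "c = d"
  using assms by (auto simp: fillings_def bij_betw_def inj_on_def)

lemma filling_onto:
  assumes "F \<in> fillings n k" "1 \<le> m" "m \<le> k * n"
  obtains c where "c \<in> cells k n" "F c = m"
proof -
  have "m \<in> F ` cells k n"
    using assms by (auto simp: fillings_def bij_betw_def)
  then show thesis using that by auto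
qed

lemma filling_range:
  assumes "F \<in> fillings n k" "c \<in> cells k n"
  shows "1 \<le> F c" "F c \<le> k * n"
  using assms by (auto simp: fillings_def bij_betw_def)

lemma rank_filling:
  assumes "F \<in> fillings n k" "c \<in> cells k n"
  shows "rank (cells k n) F c = F c"
  using assms by (intro rank_eq_self) (auto simp: fillings_def)

lemma filling_column_less_iff:
  assumes "F \<in> fillings n k" "(r, j) \<in> cells k n" "(s, j) \<in> cells k n"
  shows "F (r, j) < F (s, j) \<longleftrightarrow> r < s"
proof -
  have mono: "strict_mono_on {1..k} (\<lambda>i. F (i, j))"
    using assms by (auto simp: fillings_def mem_cells)
  show ?thesis
    using strict_mono_on_less[OF mono, of r s] assms by (simp add: mem_cells)
qed

lemma fillings_eqI:
  assumes F: "F \<in> fillings n k" and G: "G \<in> fillings n k"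
    and "\<And>c d. c \<in> cells k n \<Longrightarrow> d \<in> cells k n \<Longrightarrow> F c < F d \<longleftrightarrow> G c < G d"
  shows "F = G"
proof (rule extensionalityI[of _ "cells k n"])
  show "F \<in> extensional (cells k n)" "G \<in> extensional (cells k n)"
    using F G by (auto simp: fillings_def)
  fix c
  assume c: "c \<in> cells k n"
  have "rank (cells k n) F c = rank (cells k n) G c"
    using c assms(3) by (intro rank_cong) auto
  then show "F c = G c"
    using rank_filling[OF F c] rank_filling[OF G c] by simp
qed

lemma reduction_eq_iff:
  assumes P: "P \<in> fillings n k"
  shows "reduction k n G = P \<longleftrightarrow>
    (\<forall>c\<in>cells k n. \<forall>d\<in>cells k n. G c < G d \<longleftrightarrow> P c < P d)"
proof
  assume eq: "reduction k n G = P"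
  have "P c = rank (cells k n) G c" if "c \<in> cells k n" for c
    using that by (simp add: eq[symmetric] reduction_def rank_def)
  then show "\<forall>c\<in>cells k n. \<forall>d\<in>cells k n. G c < G d \<longleftrightarrow> P c < P d"
    by (simp add: rank_less_iff finite_cells)
next
  assume iff: "\<forall>c\<in>cells k n. \<forall>d\<in>cells k n. G c < G d \<longleftrightarrow> P c < P d"
  show "reduction k n G = P"
  proof (rule extensionalityI[of _ "cells k n"])
    show "reduction k n G \<in> extensional (cells k n)" by (simp add: reduction_def)
    show "P \<in> extensional (cells k n)" using P by (simp add: fillings_def)
    fix c
    assume c: "c \<in> cells k n"
    have "reduction k n G c = rank (cells k n) G c"
      using c by (simp add: reduction_def rank_def)
    also have "\<dots> = rank (cells k n) P c"
      using c iff by (intro rank_cong) auto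
    also have "\<dots> = P c"
      by (rule rank_filling[OF P c])
    finally show "reduction k n G c = P c" .
  qed
qed

text \<open>As columns increase in both arrays, only comparisons of an entry of the left column with an
  entry of the right one carry information.\<close>

lemma match_at_iff:
  assumes P: "P \<in> fillings 2 k" and F: "F \<in> fillings n k" and i: "1 \<le> i" "i < n"
  shows "match_at k P F i \<longleftrightarrow>
    (\<forall>r\<in>{1..k}. \<forall>s\<in>{1..k}. F (r, i) < F (s, i + 1) \<longleftrightarrow> P (r, 1) < P (s, 2))"
    (is "_ \<longleftrightarrow> ?R")
proof -
  let ?G = "column_pair k F i"
  have G1: "?G (r, 1) = F (r, i)" and G2: "?G (r, 2) = F (r, i + 1)" if "r \<in> {1..k}" for r
    using that by (auto simp: column_pair_def mem_cells)
  have m: "match_at k P F i \<longleftrightarrow>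
      (\<forall>c\<in>cells k 2. \<forall>d\<in>cells k 2. ?G c < ?G d \<longleftrightarrow> P c < P d)"
    by (simp add: match_at_def reduction_eq_iff[OF P])
  show ?thesis
  proof
    assume "match_at k P F i"
    then have "?G (r, 1) < ?G (s, 2) \<longleftrightarrow> P (r, 1) < P (s, 2)"
      if "r \<in> {1..k}" "s \<in> {1..k}" for r s
      using m that by (auto simp: mem_cells)
    then show ?R using G1 G2 by simp
  next
    assume R: ?R
    have "?G c < ?G d \<longleftrightarrow> P c < P d" if c: "c \<in> cells k 2" and d: "d \<in> cells k 2" for c d
    proof -
      obtain r a s b where cd: "c = (r, a)" "d = (s, b)" by fastforce
      have rs: "r \<in> {1..k}" "s \<in> {1..k}" using c d cd by (auto simp: mem_cells)
      have same: "F (r, j) < F (s, j) \<longleftrightarrow> r < s" if "j \<in> {i, i + 1}" for j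
        using that rs i by (intro filling_column_less_iff[OF F]) (auto simp: mem_cells)
      have sameP: "P (r, j) < P (s, j) \<longleftrightarrow> r < s" if "j \<in> {1, 2}" for j
        using that rs by (intro filling_column_less_iff[OF P]) (auto simp: mem_cells)
      have neF: "F (r, i + 1) \<noteq> F (s, i)"
        using filling_eqD[OF F, of "(r, i + 1)" "(s, i)"] rs i by (auto simp: mem_cells)
      have neP: "P (r, 2) \<noteq> P (s, 1)"
        using filling_eqD[OF P, of "(r, 2)" "(s, 1)"] rs by (auto simp: mem_cells)
      have cross: "F (r, i) < F (s, i + 1) \<longleftrightarrow> P (r, 1) < P (s, 2)"
        using R rs by blast
      have "F (s, i) < F (r, i + 1) \<longleftrightarrow> P (s, 1) < P (r, 2)"
        using R rs by blast
      then have cross': "F (r, i + 1) < F (s, i) \<longleftrightarrow> P (r, 2) < P (s, 1)"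
        using neF neP by linarith
      have "a = 1 \<or> a = 2" "b = 1 \<or> b = 2" using c d cd by (auto simp: mem_cells)
      then show ?thesis
        using same[of i] same[of "i + 1"] sameP[of 1] sameP[of 2] cross cross'
          G1[OF rs(1)] G2[OF rs(1)] G1[OF rs(2)] G2[OF rs(2)]
        by (elim disjE) (simp_all add: cd)
    qed
    then show "match_at k P F i" using m by blast
  qed
qed

lemma mem_matching_fillings_iff:
  assumes "P \<in> fillings 2 k"
  shows "F \<in> matching_fillings k P n \<longleftrightarrow> F \<in> fillings n k \<and>
    (\<forall>i\<in>{1..<n}. \<forall>r\<in>{1..k}. \<forall>s\<in>{1..k}. F (r, i) < F (s, i + 1) \<longleftrightarrow> P (r, 1) < P (s, 2))"
proof -
  have "i \<in> {1..n - 1} \<longleftrightarrow> 1 \<le> i \<and> i < n" for i by auto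
  then show ?thesis
    unfolding matching_fillings_def using match_at_iff[OF assms, of F n] by auto
qed

lemma matching_filling_less_iff:
  assumes "P \<in> fillings 2 k" "F \<in> matching_fillings k P n"
    and "(r, i) \<in> cells k n" "(s, i + 1) \<in> cells k n"
  shows "F (r, i) < F (s, i + 1) \<longleftrightarrow> P (r, 1) < P (s, 2)"
  using assms mem_matching_fillings_iff[OF assms(1), of F n] by (auto simp: mem_cells)

lemma standard_row_less:
  assumes "P \<in> standard_tableaux2 k" "1 \<le> r" "r \<le> k"
  shows "P (r, 1) < P (r, 2)"
  using assms by (auto simp: standard_tableaux2_def strict_mono_on_def)

text \<open>Here it matters that \<open>P\<close> is a standard tableau: rows of matching fillings increase.\<close>

lemma matching_filling_row_less:
  assumes P: "P \<in> standard_tableaux2 k" and F: "F \<in> matching_fillings k P n"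
    and "1 \<le> r" "r \<le> k" "1 \<le> i" "i < j" "j \<le> n"
  shows "F (r, i) < F (r, j)"
  using \<open>i < j\<close> \<open>j \<le> n\<close>
proof (induction j)
  case (Suc j)
  have "F (r, j) < F (r, j + 1)"
    using matching_filling_less_iff[OF _ F, of r j r] standard_row_less[OF P, of r] P Suc.prems assms
    by (simp add: standard_tableaux2_def mem_cells)
  with Suc show ?case by (cases "i = j") auto
qed simp

section \<open>Uniqueness and consecutive entries\<close>

text \<open>Neither the columns nor the matches compare the exchanged cells, and every other entry lies
  on the same side of both of them.\<close>

lemma swap_in_matching_fillings:
  assumes P: "P \<in> fillings 2 k" and F: "F \<in> matching_fillings k P n"
    and x: "(a, i) \<in> cells k n" and y: "(b, j) \<in> cells k n"
    and consec: "F (b, j) = F (a, i) + 1" and far: "i + 1 < j \<or> j + 1 < i"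
  shows "F \<circ> transpose (a, i) (b, j) \<in> matching_fillings k P n"
proof -
  let ?t = "transpose (a, i) (b, j)" and ?C = "cells k n"
  have Ff: "F \<in> fillings n k"
    using F by (simp add: matching_fillings_def)
  have less: "(F \<circ> ?t) (r, c) < (F \<circ> ?t) (s, d) \<longleftrightarrow> F (r, c) < F (s, d)"
    if rc: "(r, c) \<in> ?C" and sd: "(s, d) \<in> ?C" and near: "c = d \<or> d = c + 1" for r c s d
  proof -
    have ne: "F (p, q) \<noteq> F (a, i)" "F (p, q) \<noteq> F (b, j)"
      if "(p, q) \<in> ?C" "(p, q) \<noteq> (a, i)" "(p, q) \<noteq> (b, j)" for p q
      using filling_eqD[OF Ff that(1)] that x y by blast+
    consider "(r, c) = (a, i)" "(s, d) = (a, i)" | "(r, c) = (b, j)" "(s, d) = (b, j)"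
      | "(r, c) = (a, i)" "(s, d) \<noteq> (a, i)" "(s, d) \<noteq> (b, j)"
      | "(r, c) = (b, j)" "(s, d) \<noteq> (a, i)" "(s, d) \<noteq> (b, j)"
      | "(r, c) \<noteq> (a, i)" "(r, c) \<noteq> (b, j)" "(s, d) = (a, i)"
      | "(r, c) \<noteq> (a, i)" "(r, c) \<noteq> (b, j)" "(s, d) = (b, j)"
      | "(r, c) \<noteq> (a, i)" "(r, c) \<noteq> (b, j)" "(s, d) \<noteq> (a, i)" "(s, d) \<noteq> (b, j)"
      using near far by fastforce
    then show ?thesis
    proof cases
      case 3
      then show ?thesis using ne[OF sd] consec by auto
    next
      case 4
      then show ?thesis using ne[OF sd] consec by auto
    next
      case 5
      then show ?thesis using ne[OF rc] consec by auto
    next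
      case 6
      then show ?thesis using ne[OF rc] consec by auto
    next
      case 7
      then show ?thesis by (simp only: o_apply transpose_apply_other not_False_eq_True)
    qed simp_all
  qed
  have "F \<circ> ?t \<in> extensional ?C"
    using Ff x y by (auto simp: fillings_def extensional_def transpose_def)
  moreover have "bij_betw ?t ?C ?C"
    using x y by (intro bij_betw_byWitness[where f' = ?t]) (auto simp: transpose_def)
  then have "bij_betw (F \<circ> ?t) ?C {1..k * n}"
    using Ff by (auto simp: fillings_def intro: bij_betw_trans)
  moreover have "strict_mono_on {1..k} (\<lambda>r. (F \<circ> ?t) (r, c))" if "c \<in> {1..n}" for c
  proof (rule strict_mono_onI)
    fix r s
    assume "r \<in> {1..k}" "s \<in> {1..k}" "r < s"
    then show "(F \<circ> ?t) (r, c) < (F \<circ> ?t) (s, c)"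
      using less[of r c s c] filling_column_less_iff[OF Ff, of r c s] that
      by (simp add: mem_cells)
  qed
  ultimately have "F \<circ> ?t \<in> fillings n k"
    unfolding fillings_def by blast
  moreover have "(F \<circ> ?t) (r, c) < (F \<circ> ?t) (s, c + 1) \<longleftrightarrow> P (r, 1) < P (s, 2)"
    if "c \<in> {1..<n}" "r \<in> {1..k}" "s \<in> {1..k}" for r s c
    using less[of r c s "c + 1"] matching_filling_less_iff[OF P F, of r c s] that
    by (simp add: mem_cells)
  ultimately show ?thesis
    by (simp add: mem_matching_fillings_iff[OF P])
qed

text \<open>Consecutive entries of \<open>F\<close> in equal or neighbouring columns are ordered in the same way in every
  matching filling, so any other one increases along the order given by \<open>F\<close>.\<close>

lemma matching_filling_unique:
  assumes P: "P \<in> fillings 2 k"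
    and F: "F \<in> matching_fillings k P n" and G: "G \<in> matching_fillings k P n"
    and near: "\<And>a i b j. (a, i) \<in> cells k n \<Longrightarrow> (b, j) \<in> cells k n \<Longrightarrow>
      F (b, j) = F (a, i) + 1 \<Longrightarrow> i \<le> j + 1 \<and> j \<le> i + 1"
  shows "F = G"
proof (rule fillings_eqI)
  show Ff: "F \<in> fillings n k" and Gf: "G \<in> fillings n k"
    using F G by (auto simp: matching_fillings_def)
  have step: "G x < G y" if xy: "x \<in> cells k n" "y \<in> cells k n" and succ: "F y = F x + 1" for x y
  proof -
    obtain a i b j where eq: "x = (a, i)" "y = (b, j)" by fastforce
    consider "i = j" | "j = i + 1" | "i = j + 1"
      using near[of a i b j] xy succ eq by fastforce
    then show ?thesis
    proof cases
      case 1
      then show ?thesis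
        using filling_column_less_iff[OF Ff, of a i b] filling_column_less_iff[OF Gf, of a i b]
          xy succ eq by simp
    next
      case 2
      then show ?thesis
        using matching_filling_less_iff[OF P F, of a i b] matching_filling_less_iff[OF P G, of a i b]
          xy succ eq by simp
    next
      case 3
      then have "\<not> G (b, j) < G (a, i)"
        using matching_filling_less_iff[OF P F, of b j a] matching_filling_less_iff[OF P G, of b j a]
          xy succ eq by simp
      moreover have "G (b, j) \<noteq> G (a, i)"
        using filling_eqD[OF Gf xy] succ eq by force
      ultimately show ?thesis using eq by simp
    qed
  qed
  have le: "G x < G y" if "x \<in> cells k n" "y \<in> cells k n" "F x < F y" for x y
    using that
  proof (induction "F y" arbitrary: y rule: less_induct)
    case less
    obtain z where z: "z \<in> cells k n" "F z = F y - 1"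
    proof (rule filling_onto[OF Ff, of "F y - 1"])
      show "1 \<le> F y - 1" "F y - 1 \<le> k * n"
        using filling_range[OF Ff less.prems(1)] filling_range[OF Ff less.prems(2)] less.prems(3)
        by simp_all
    qed (use that in blast)
    have "G z < G y"
      using step[OF z(1) less.prems(2)] z less.prems by simp
    show ?case
    proof (cases "F x < F z")
      case True
      then have "G x < G z"
        using less.hyps[of z] z less.prems by simp
      with \<open>G z < G y\<close> show ?thesis by simp
    next
      case False
      then have "x = z"
        using filling_eqD[OF Ff less.prems(1) z(1)] z less.prems by simp
      with \<open>G z < G y\<close> show ?thesis by simp
    qed
  qed
  fix x y
  assume xy: "x \<in> cells k n" "y \<in> cells k n"
  have "\<not> G x < G y" if "\<not> F x < F y"
  proof (cases "F x = F y")
    case True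
    then show ?thesis using filling_eqD[OF Ff xy] by simp
  next
    case False
    then show ?thesis using le[OF xy(2,1)] that by simp
  qed
  with le[OF xy] show "F x < F y \<longleftrightarrow> G x < G y" by blast
qed

section \<open>Existence\<close>

lemma exists_between_avoiding:
  fixes L U Z :: "real set"
  assumes fin: "finite L" "finite U" "finite Z" and less: "\<And>l u. l \<in> L \<Longrightarrow> u \<in> U \<Longrightarrow> l < u"
  obtains y where "y \<notin> Z" "\<And>l. l \<in> L \<Longrightarrow> l < y" "\<And>u. u \<in> U \<Longrightarrow> y < u"
proof -
  define lo where "lo = Min (insert 0 (L \<union> U)) - 1"
  define hi where "hi = Max (insert 0 (L \<union> U)) + 1"
  have fin': "finite (insert 0 (L \<union> U))" using fin by simp
  have lo: "lo < z" and hi: "z < hi" if "z \<in> insert 0 (L \<union> U)" for z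
    using Min_le[OF fin' that] Max_ge[OF fin' that] by (auto simp: lo_def hi_def)
  have "lo < hi" using lo[of 0] hi[of 0] by simp
  have "Max (insert lo L) < Min (insert hi U)"
    using fin less lo hi \<open>lo < hi\<close> by auto
  then have "infinite ({Max (insert lo L)<..<Min (insert hi U)} - Z)"
    using fin by simp
  then obtain y where "y \<notin> Z" "Max (insert lo L) < y" "y < Min (insert hi U)"
    by (metis DiffE finite.emptyI ex_in_conv greaterThanLessThan_iff)
  with that show thesis using fin by auto
qed

text \<open>The set \<open>Z\<close> of forbidden values serves to keep the labels of a new column distinct from all
  labels used before.\<close>

lemma strict_mono_on_extend_avoiding:
  fixes f :: "'a::linorder \<Rightarrow> real"
  assumes "finite B" "finite A" "finite Z" "strict_mono_on A f" "A \<inter> B = {}"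
  shows "\<exists>g. strict_mono_on (A \<union> B) g \<and> (\<forall>x\<in>A. g x = f x) \<and> g ` B \<inter> Z = {}"
  using assms(1,5)
proof (induction B)
  case empty
  then show ?case using assms(4) by auto
next
  case (insert x B)
  then obtain g where g: "strict_mono_on (A \<union> B) g" "\<forall>x\<in>A. g x = f x" "g ` B \<inter> Z = {}"
    by auto
  have x: "x \<notin> A \<union> B" using insert by auto
  obtain y where y: "y \<notin> Z" "\<And>a. a \<in> A \<union> B \<Longrightarrow> a < x \<Longrightarrow> g a < y"
      "\<And>a. a \<in> A \<union> B \<Longrightarrow> x < a \<Longrightarrow> y < g a"
  proof (rule exists_between_avoiding[of "g ` {a \<in> A \<union> B. a < x}" "g ` {a \<in> A \<union> B. x < a}" Z])
    show "l < u" if "l \<in> g ` {a \<in> A \<union> B. a < x}" "u \<in> g ` {a \<in> A \<union> B. x < a}" for l u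
    proof -
      obtain p q where "p \<in> A \<union> B" "q \<in> A \<union> B" "p < x" "x < q" "l = g p" "u = g q"
        using \<open>l \<in> _\<close> \<open>u \<in> _\<close> by blast
      then show ?thesis using strict_mono_onD[OF g(1), of p q] by simp
    qed
  qed (use assms insert.hyps in auto)
  let ?h = "g(x := y)"
  have "strict_mono_on (A \<union> insert x B) ?h"
  proof (rule strict_mono_onI)
    fix p q
    assume "p \<in> A \<union> insert x B" "q \<in> A \<union> insert x B" "p < q"
    then show "?h p < ?h q"
      using y(2)[of p] y(3)[of q] strict_mono_onD[OF g(1), of p q] by auto
  qed
  moreover have "\<forall>a\<in>A. ?h a = f a" using g(2) x by auto
  moreover have "?h ` insert x B \<inter> Z = {}" using g(3) y(1) insert.hyps by auto
  ultimately show ?case by blast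
qed

lemma exists_real_labelling:
  assumes P: "P \<in> fillings 2 k"
  shows "\<exists>v :: nat \<times> nat \<Rightarrow> real. inj_on v (cells k n) \<and>
    (\<forall>j\<in>{1..n}. strict_mono_on {1..k} (\<lambda>r. v (r, j))) \<and>
    (\<forall>i\<in>{1..<n}. \<forall>r\<in>{1..k}. \<forall>s\<in>{1..k}. v (r, i) < v (s, i + 1) \<longleftrightarrow> P (r, 1) < P (s, 2))"
proof (induction n)
  case 0
  show ?case by (simp add: cells_def)
next
  case (Suc n)
  then obtain v :: "nat \<times> nat \<Rightarrow> real" where v: "inj_on v (cells k n)"
    "\<And>j. j \<in> {1..n} \<Longrightarrow> strict_mono_on {1..k} (\<lambda>r. v (r, j))"
    "\<And>i r s. i \<in> {1..<n} \<Longrightarrow> r \<in> {1..k} \<Longrightarrow> s \<in> {1..k} \<Longrightarrow>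
       v (r, i) < v (s, i + 1) \<longleftrightarrow> P (r, 1) < P (s, 2)"
    by blast
  \<comment> \<open>The first column is unconstrained, as no earlier column prescribes values.\<close>
  define A where "A = (if n = 0 then {} else (\<lambda>r. P (r, 1)) ` {1..k})"
  define B where "B = (\<lambda>s. P (s, 2)) ` {1..k}"
  define f where "f = (\<lambda>p. v (the_inv_into {1..k} (\<lambda>r. P (r, 1)) p, n))"
  have mono: "strict_mono_on {1..k} (\<lambda>r. P (r, j))" if "j \<in> {1, 2}" for j
    using P that by (auto simp: fillings_def)
  have inj: "inj_on (\<lambda>r. P (r, 1)) {1..k}"
    using mono[of 1] strict_mono_on_imp_inj_on by blast
  have f: "f (P (r, 1)) = v (r, n)" if "r \<in> {1..k}" for r
    using the_inv_into_f_f[OF inj that] by (simp add: f_def)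
  have "strict_mono_on A f"
  proof (rule strict_mono_onI)
    fix p q
    assume "p \<in> A" "q \<in> A" "p < q"
    then obtain r s where rs: "r \<in> {1..k}" "s \<in> {1..k}" "p = P (r, 1)" "q = P (s, 1)" "n \<noteq> 0"
      by (auto simp: A_def split: if_splits)
    have "r < s"
      using strict_mono_on_less[OF mono[of 1], of r s] rs \<open>p < q\<close> by simp
    then show "f p < f q"
      using strict_mono_onD[OF v(2)[of n], of r s] rs f by simp
  qed
  moreover have "A \<inter> B = {}"
  proof -
    have "P (r, 1) \<noteq> P (s, 2)" if "r \<in> {1..k}" "s \<in> {1..k}" for r s
      using filling_eqD[OF P, of "(r, 1)" "(s, 2)"] that by (auto simp: mem_cells)
    then show ?thesis by (auto simp: A_def B_def)
  qed
  moreover have "finite A" "finite B" "finite (v ` cells k n)"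
    by (auto simp: A_def B_def finite_cells)
  ultimately obtain g where g: "strict_mono_on (A \<union> B) g" "\<And>x. x \<in> A \<Longrightarrow> g x = f x"
      "g ` B \<inter> v ` cells k n = {}"
    using strict_mono_on_extend_avoiding[of B A "v ` cells k n" f] by blast
  define w where "w = (\<lambda>(r, j). if j = Suc n then g (P (r, 2)) else v (r, j))"
  have w_old: "w (r, j) = v (r, j)" if "j \<le> n" for r j
    using that by (simp add: w_def)
  have w_new: "w (r, Suc n) = g (P (r, 2))" for r
    by (simp add: w_def)
  have w_mono: "strict_mono_on {1..k} (\<lambda>r. w (r, j))" if "j \<in> {1..Suc n}" for j
  proof (cases "j = Suc n")
    case True
    have "g (P (r, 2)) < g (P (s, 2))" if "r \<in> {1..k}" "s \<in> {1..k}" "r < s" for r s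
      using strict_mono_onD[OF g(1), of "P (r, 2)" "P (s, 2)"]
        strict_mono_onD[OF mono[of 2], of r s] that by (auto simp: B_def)
    with True show ?thesis by (auto intro!: strict_mono_onI simp: w_new)
  next
    case False
    with that show ?thesis using v(2)[of j] by (simp add: w_old)
  qed
  moreover have "inj_on w (cells k (Suc n))"
  proof (rule inj_onI, clarify)
    fix r i s j
    assume c: "(r, i) \<in> cells k (Suc n)" and d: "(s, j) \<in> cells k (Suc n)"
      and eq: "w (r, i) = w (s, j)"
    have new_old: False
      if "p \<in> {1..k}" "(q, l) \<in> cells k n" "g (P (p, 2)) = v (q, l)" for p q l
    proof -
      have "P (p, 2) \<in> B" using that(1) by (auto simp: B_def)
      then show False using g(3) that(2,3) by (metis IntI emptyE imageI)
    qed
    consider "i = Suc n" "j = Suc n" | "i = Suc n" "j \<le> n" | "i \<le> n" "j = Suc n" | "i \<le> n" "j \<le> n"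
      using c d by (auto simp: mem_cells le_Suc_eq)
    then show "r = s \<and> i = j"
    proof cases
      case 1
      then show ?thesis
        using strict_mono_on_eqD[OF w_mono[of "Suc n"], of r s] eq c d by (auto simp: mem_cells)
    next
      case 2
      then show ?thesis
        using new_old[of r s j] eq c d by (auto simp: mem_cells w_new w_old)
    next
      case 3
      then show ?thesis
        using new_old[of s r i] eq c d by (auto simp: mem_cells w_new w_old)
    next
      case 4
      then show ?thesis
        using inj_onD[OF v(1), of "(r, i)" "(s, j)"] eq c d by (auto simp: mem_cells w_old)
    qed
  qed
  moreover have "w (r, i) < w (s, i + 1) \<longleftrightarrow> P (r, 1) < P (s, 2)"
    if i: "i \<in> {1..<Suc n}" and r: "r \<in> {1..k}" and s: "s \<in> {1..k}" for i r s
  proof (cases "i = n")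
    case True
    then have "n \<noteq> 0" using i by simp
    then have A: "P (r, 1) \<in> A" and B: "P (s, 2) \<in> B" using r s by (auto simp: A_def B_def)
    have "w (r, i) < w (s, i + 1) \<longleftrightarrow> g (P (r, 1)) < g (P (s, 2))"
      using True w_old[of n r] w_new[of s] f[OF r] g(2)[OF A] by simp
    also have "\<dots> \<longleftrightarrow> P (r, 1) < P (s, 2)"
      using strict_mono_on_less[OF g(1)] A B by blast
    finally show ?thesis .
  next
    case False
    then show ?thesis using v(3)[of i r s] i r s by (simp add: w_old)
  qed
  ultimately show ?case by blast
qed

lemma matching_fillings_nonempty:
  assumes P: "P \<in> fillings 2 k"
  shows "matching_fillings k P n \<noteq> {}"
proof -
  let ?C = "cells k n"
  obtain v :: "nat \<times> nat \<Rightarrow> real" where v: "inj_on v ?C"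
    "\<And>j. j \<in> {1..n} \<Longrightarrow> strict_mono_on {1..k} (\<lambda>r. v (r, j))"
    "\<And>i r s. i \<in> {1..<n} \<Longrightarrow> r \<in> {1..k} \<Longrightarrow> s \<in> {1..k} \<Longrightarrow>
       v (r, i) < v (s, i + 1) \<longleftrightarrow> P (r, 1) < P (s, 2)"
    using exists_real_labelling[OF P, of n] by blast
  define F where "F = restrict (rank ?C v) ?C"
  have less: "F c < F d \<longleftrightarrow> v c < v d" if "c \<in> ?C" "d \<in> ?C" for c d
    using that by (simp add: F_def rank_less_iff finite_cells)
  have "bij_betw (rank ?C v) ?C {1..k * n}"
    using rank_bij_betw[OF finite_cells v(1)] by (simp add: cells_def)
  then have "bij_betw F ?C {1..k * n}"
    by (rule bij_betw_cong[THEN iffD1, rotated]) (simp add: F_def)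
  moreover have "strict_mono_on {1..k} (\<lambda>r. F (r, j))" if "j \<in> {1..n}" for j
  proof (rule strict_mono_onI)
    fix r s
    assume "r \<in> {1..k}" "s \<in> {1..k}" "r < s"
    then show "F (r, j) < F (s, j)"
      using that strict_mono_onD[OF v(2)[OF that], of r s] less by (simp add: mem_cells)
  qed
  ultimately have "F \<in> fillings n k"
    by (simp add: fillings_def F_def)
  moreover have "F (r, i) < F (s, i + 1) \<longleftrightarrow> P (r, 1) < P (s, 2)"
    if "i \<in> {1..<n}" "r \<in> {1..k}" "s \<in> {1..k}" for i r s
    using less[of "(r, i)" "(s, i + 1)"] v(3)[OF that] that by (simp add: mem_cells)
  ultimately have "F \<in> matching_fillings k P n"
    by (simp add: mem_matching_fillings_iff[OF P])
  then show ?thesis by blast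
qed

section \<open>Degeneracy\<close>

text \<open>A value between the lowest and the highest entry of a column, and not in the column, falls
  between two successive rows.\<close>

lemma exists_row_around:
  assumes F: "F \<in> fillings n k" and c: "1 \<le> c" "c \<le> n"
    and "1 \<le> k" "F (1, c) < m" "m < F (k, c)"
    and ne: "\<And>r. (r, c) \<in> cells k n \<Longrightarrow> F (r, c) \<noteq> m"
  obtains r where "1 \<le> r" "r < k" "F (r, c) < m" "m < F (r + 1, c)"
proof -
  have "\<exists>r. 1 \<le> r \<and> r < l \<and> F (r, c) < m \<and> m < F (r + 1, c)"
    if "m < F (l, c)" "1 \<le> l" "l \<le> k" for l
    using that(2) that(1,3)
  proof (induction l rule: dec_induct)
    case base
    then show ?case using assms(5) by simp
  next
    case (step l)
    then show ?case
      using ne[of l] c by (cases "m < F (l, c)") (force simp: mem_cells)+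
  qed
  from this[OF assms(6,4)] that show thesis by blast
qed

text \<open>The two alternatives for the order of the entries make the lemma applicable with the cells
  exchanged, so that it bounds the distance of the columns on both sides.\<close>

lemma degenerate_consecutive_near:
  assumes P: "P \<in> standard_tableaux2 k" and deg: "degenerate k P"
    and F: "F \<in> matching_fillings k P n"
    and x: "(a, i) \<in> cells k n" and y: "(b, j) \<in> cells k n"
    and consec: "F (b, j) = F (a, i) + 1 \<or> F (a, i) = F (b, j) + 1"
  shows "j \<le> i + 1"
proof (rule ccontr)
  assume far: "\<not> j \<le> i + 1"
  have Pf: "P \<in> fillings 2 k" using P by (simp add: standard_tableaux2_def)
  have Ff: "F \<in> fillings n k" using F by (simp add: matching_fillings_def)
  have bounds: "1 \<le> a" "a \<le> k" "1 \<le> i" "j \<le> n" "1 \<le> b" "b \<le> k"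
    using x y by (auto simp: mem_cells)
  \<comment> \<open>The entries of \<open>(a, i)\<close> and \<open>(b, j)\<close> are indistinguishable from the columns in between.\<close>
  have same_side: "F (r, c) < F (a, i) \<longleftrightarrow> F (r, c) < F (b, j)"
      "F (a, i) < F (r, c) \<longleftrightarrow> F (b, j) < F (r, c)"
    if "(r, c) \<in> cells k n" "i < c" "c < j" for r c
  proof -
    have "F (r, c) \<noteq> F (a, i)" "F (r, c) \<noteq> F (b, j)"
      using filling_eqD[OF Ff that(1) x] filling_eqD[OF Ff that(1) y] that by auto
    then show "F (r, c) < F (a, i) \<longleftrightarrow> F (r, c) < F (b, j)"
        "F (a, i) < F (r, c) \<longleftrightarrow> F (b, j) < F (r, c)"
      using consec by auto
  qed
  have row: "\<exists>r. 1 \<le> r \<and> r < k \<and> F (r, c) < F (a, i) \<and> F (a, i) < F (r + 1, c)"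
    if c: "i < c" "c < j" for c
  proof -
    have cells: "(r, c) \<in> cells k n" if "1 \<le> r" "r \<le> k" for r
      using that c bounds by (simp add: mem_cells)
    have "F (1, c) < F (1, j)"
      using matching_filling_row_less[OF P F, of 1 c j] c bounds by simp
    also have "F (1, j) \<le> F (b, j)"
      using filling_column_less_iff[OF Ff, of b j 1] y bounds by (simp add: mem_cells not_less[symmetric])
    finally have lo: "F (1, c) < F (a, i)"
      using same_side(1)[OF cells c] bounds by simp
    have "F (a, i) \<le> F (k, i)"
      using filling_column_less_iff[OF Ff, of k i a] x bounds by (simp add: mem_cells not_less[symmetric])
    also have "F (k, i) < F (k, c)"
      using matching_filling_row_less[OF P F, of k i c] c bounds by simp
    finally have hi: "F (a, i) < F (k, c)" .
    have "F (r, c) \<noteq> F (a, i)" if "(r, c) \<in> cells k n" for r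
      using filling_eqD[OF Ff that x] c by auto
    then obtain r where "1 \<le> r" "r < k" "F (r, c) < F (a, i)" "F (a, i) < F (r + 1, c)"
      using exists_row_around[OF Ff _ _ _ lo hi] c bounds by auto
    then show ?thesis by blast
  qed
  have cross: "F (r, c) < F (s, c + 1) \<longleftrightarrow> P (r, 1) < P (s, 2)"
      "F (s, c + 1) < F (r, c) \<longleftrightarrow> P (s, 2) < P (r, 1)"
    if "1 \<le> r" "r \<le> k" "1 \<le> s" "s \<le> k" "i \<le> c" "c < j" for r s c
  proof -
    have cells: "(r, c) \<in> cells k n" "(s, c + 1) \<in> cells k n"
      using that bounds by (auto simp: mem_cells)
    show *: "F (r, c) < F (s, c + 1) \<longleftrightarrow> P (r, 1) < P (s, 2)"
      by (rule matching_filling_less_iff[OF Pf F cells])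
    have "F (s, c + 1) \<noteq> F (r, c)" "P (s, 2) \<noteq> P (r, 1)"
      using filling_eqD[OF Ff cells] filling_eqD[OF Pf, of "(s, 2)" "(r, 1)"] that
      by (auto simp: mem_cells)
    with * show "F (s, c + 1) < F (r, c) \<longleftrightarrow> P (s, 2) < P (r, 1)"
      by linarith
  qed
  have adjacent: "P (r, 1) + 1 = P (r + 1, 1)"
    if "1 \<le> r" "r < k" "P (r, 2) < P (t, 1)" "P (t, 1) < P (r + 1, 2)" for r t
    using deg that by (force simp: degenerate_def)
  \<comment> \<open>The property that travels from column \<open>i + 1\<close> to column \<open>j - 1\<close>.\<close>
  have chain: "\<exists>t. 1 \<le> t \<and> t \<le> k \<and> P (r, 2) < P (t, 1) \<and> P (t, 1) < P (r + 1, 2)"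
    if "i + 1 \<le> c" "c < j" "1 \<le> r" "r < k" "F (r, c) < F (a, i)" "F (a, i) < F (r + 1, c)" for c r
    using that
  proof (induction c arbitrary: r rule: dec_induct)
    case base
    \<comment> \<open>The cell \<open>(a, i)\<close> itself provides \<open>t = a\<close>.\<close>
    then show ?case
      using cross[of a r i] cross[of a "r + 1" i] bounds by auto
  next
    case (step c)
    obtain q where q: "1 \<le> q" "q < k" "F (q, c) < F (a, i)" "F (a, i) < F (q + 1, c)"
      using row[of c] step by auto
    then obtain t where "P (q, 2) < P (t, 1)" "P (t, 1) < P (q + 1, 2)"
      using step.IH[of q] step.prems by auto
    then have q1: "P (q, 1) + 1 = P (q + 1, 1)"
      using adjacent q by blast
    have "P (r, 2) < P (q + 1, 1)"
      using cross(2)[of "q + 1" r c] q step by auto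
    moreover have "P (q, 1) < P (r + 1, 2)"
      using cross(1)[of q "r + 1" c] q step by auto
    moreover have "P (r + 1, 2) \<noteq> P (q + 1, 1)"
      using filling_eqD[OF Pf, of "(r + 1, 2)" "(q + 1, 1)"] q step.prems by (auto simp: mem_cells)
    ultimately have "P (r, 2) < P (q + 1, 1)" "P (q + 1, 1) < P (r + 1, 2)"
      using q1 by auto
    then show ?case using q by (intro exI[of _ "q + 1"]) auto
  qed
  obtain c where c: "j = c + 1" "i + 1 \<le> c"
    using that[of "j - 1"] far by simp
  then obtain r where r: "1 \<le> r" "r < k" "F (r, c) < F (a, i)" "F (a, i) < F (r + 1, c)"
    using row[of c] by auto
  have "i < c" "c < j" using c by simp_all
  obtain t where "P (r, 2) < P (t, 1)" "P (t, 1) < P (r + 1, 2)"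
    using chain[OF c(2) \<open>c < j\<close> r] by blast
  then have "P (r, 1) + 1 = P (r + 1, 1)"
    by (rule adjacent[OF r(1,2)])
  moreover have "F (r, c) < F (b, c + 1)" "F (b, c + 1) < F (r + 1, c)"
  proof -
    have "(r, c) \<in> cells k n" "(r + 1, c) \<in> cells k n"
      using r c bounds by (auto simp: mem_cells)
    then show "F (r, c) < F (b, c + 1)" "F (b, c + 1) < F (r + 1, c)"
      using same_side(1)[of r c] same_side(2)[of "r + 1" c] r(3,4) \<open>i < c\<close> \<open>c < j\<close>
      unfolding c(1) by blast+
  qed
  then have "P (r, 1) < P (b, 2)" "P (b, 2) < P (r + 1, 1)"
    using cross(1)[of r b c] cross(2)[of "r + 1" b c] r(1,2) \<open>i < c\<close> \<open>c < j\<close> bounds by simp_all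
  ultimately show False by simp
qed

text \<open>The value following \<open>P(r, 1)\<close> has to lie in the second column if it is not \<open>P(r + 1, 1)\<close>, and
  the same holds with the columns exchanged.\<close>

lemma not_degenerate_gaps:
  assumes P: "P \<in> fillings 2 k" and "\<not> degenerate k P"
  obtains r s t where "1 \<le> r" "r < k" "1 \<le> s" "s \<le> k" "1 \<le> t" "t \<le> k"
    "P (r, 1) < P (s, 2)" "P (s, 2) < P (r + 1, 1)"
    "P (r, 2) < P (t, 1)" "P (t, 1) < P (r + 1, 2)"
proof -
  obtain r where r: "1 \<le> r" "r < k" "P (r, 1) + 1 \<noteq> P (r + 1, 1)" "P (r, 2) + 1 \<noteq> P (r + 1, 2)"
    using assms(2) by (auto simp: degenerate_def)
  have gap: "\<exists>s. 1 \<le> s \<and> s \<le> k \<and> P (r, c) < P (s, d) \<and> P (s, d) < P (r + 1, c)"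
    if cd: "c \<in> {1, 2}" "d = 3 - c" "P (r, c) + 1 \<noteq> P (r + 1, c)" for c d
  proof -
    have cells: "(r, c) \<in> cells k 2" "(r + 1, c) \<in> cells k 2"
      using r cd by (auto simp: mem_cells)
    have less: "P (r, c) + 1 < P (r + 1, c)"
      using filling_column_less_iff[OF P cells] cd(3) by simp
    obtain s e where se: "(s, e) \<in> cells k 2" "P (s, e) = P (r, c) + 1"
    proof -
      have "P (r, c) + 1 \<le> k * 2" using less filling_range(2)[OF P cells(2)] by linarith
      then show thesis using filling_onto[OF P, of "P (r, c) + 1"] that by fastforce
    qed
    have "e \<noteq> c"
    proof
      assume "e = c"
      then have "(s, c) \<in> cells k 2" "P (r, c) < P (s, c)" "P (s, c) < P (r + 1, c)"
        using se less by simp_all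
      then have "r < s" "s < r + 1"
        using filling_column_less_iff[OF P] cells by blast+
      then show False by simp
    qed
    then have "e = d" using se(1) cd by (auto simp: mem_cells)
    then show ?thesis using se less by (intro exI[of _ s]) (auto simp: mem_cells)
  qed
  have "(1 :: nat) \<in> {1, 2}" "(2 :: nat) = 3 - 1" "(2 :: nat) \<in> {1, 2}" "(1 :: nat) = 3 - 2"
    by simp_all
  note gaps = gap[OF this(1,2) r(3)] gap[OF this(3,4) r(4)]
  obtain s where "1 \<le> s" "s \<le> k" "P (r, 1) < P (s, 2)" "P (s, 2) < P (r + 1, 1)"
    using gaps(1) by blast
  moreover obtain t where "1 \<le> t" "t \<le> k" "P (r, 2) < P (t, 1)" "P (t, 1) < P (r + 1, 2)"
    using gaps(2) by blast
  ultimately show thesis using that[OF r(1,2)] by blast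
qed

lemma exists_consecutive_change:
  fixes p q :: nat
  assumes "p < q" "Q p \<noteq> Q q"
  obtains m where "p \<le> m" "m < q" "Q m \<noteq> Q (m + 1)"
proof -
  have "\<exists>m. p \<le> m \<and> m < q \<and> Q m \<noteq> Q (m + 1)"
  proof (rule ccontr)
    assume none: "\<nexists>m. p \<le> m \<and> m < q \<and> Q m \<noteq> Q (m + 1)"
    have "Q l = Q p" if "p \<le> l" "l \<le> q" for l
      using that
    proof (induction l rule: dec_induct)
      case (step l)
      then have "Q l = Q (l + 1)" using none by auto
      with step show ?case by simp
    qed simp
    from this[of q] show False using assms by simp
  qed
  with that show thesis by blast
qed

lemma not_degenerate_not_unique:
  assumes P: "P \<in> fillings 2 k" and nd: "\<not> degenerate k P" and F: "F \<in> matching_fillings k P 3"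
  shows "\<exists>G\<in>matching_fillings k P 3. G \<noteq> F"
proof -
  have Ff: "F \<in> fillings 3 k" using F by (simp add: matching_fillings_def)
  obtain r s t where r: "1 \<le> r" "r < k" and s: "1 \<le> s" "s \<le> k" and t: "1 \<le> t" "t \<le> k"
    and Ps: "P (r, 1) < P (s, 2)" "P (s, 2) < P (r + 1, 1)"
    and Pt: "P (r, 2) < P (t, 1)" "P (t, 1) < P (r + 1, 2)"
    using not_degenerate_gaps[OF P nd] by blast
  have cells: "(p, c) \<in> cells k 3 \<longleftrightarrow> 1 \<le> p \<and> p \<le> k \<and> c \<in> {1, 2, 3}" for p c
    by (auto simp: mem_cells)
  have less: "F (p, c) < F (q, c + 1) \<longleftrightarrow> P (p, 1) < P (q, 2)"
    if "1 \<le> p" "p \<le> k" "1 \<le> q" "q \<le> k" "c \<in> {1, 2}" for p q c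
    using that by (intro matching_filling_less_iff[OF P F]) (auto simp: mem_cells)
  have ne: "F (p, c) \<noteq> F (q, d)"
    if "(p, c) \<in> cells k 3" "(q, d) \<in> cells k 3" "c \<noteq> d" for p q c d
    using filling_eqD[OF Ff that(1,2)] that(3) by auto
  have t1: "F (r, 2) < F (t, 1)" "F (t, 1) < F (r + 1, 2)"
    using less[of t r 1] less[of t "r + 1" 1] ne[of t 1 r 2] r t Pt by (auto simp: cells numeral_2_eq_2)
  have s3: "F (r, 2) < F (s, 3)" "F (s, 3) < F (r + 1, 2)"
    using less[of r s 2] less[of "r + 1" s 2] ne[of "r + 1" 2 s 3] r s Ps by (auto simp: cells)
  have gap: "c \<in> {1, 3}"
    if "(p, c) \<in> cells k 3" "F (r, 2) < F (p, c)" "F (p, c) < F (r + 1, 2)" for p c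
  proof -
    have "c \<noteq> 2"
      using filling_column_less_iff[OF Ff, of r 2 p] filling_column_less_iff[OF Ff, of p 2 "r + 1"]
        that r by (auto simp: cells)
    then show ?thesis using that(1) by (auto simp: cells)
  qed
  \<comment> \<open>Entries strictly between those of the cells \<open>(r, 2)\<close> and \<open>(r + 1, 2)\<close> lie in column 1 or 3,
    and \<open>Q\<close> tells which. It changes between the entries of \<open>(t, 1)\<close> and \<open>(s, 3)\<close>.\<close>
  define Q where "Q m \<longleftrightarrow> (\<exists>p. (p, 1) \<in> cells k 3 \<and> F (p, 1) = m)" for m
  have "Q (F (t, 1))" using t by (auto simp: Q_def cells)
  moreover have "\<not> Q (F (s, 3))" using ne[of _ 1 s 3] s by (auto simp: Q_def cells)
  ultimately have "Q (F (t, 1)) \<noteq> Q (F (s, 3))" "F (t, 1) \<noteq> F (s, 3)" by auto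
  then obtain m where "min (F (t, 1)) (F (s, 3)) \<le> m" "m < max (F (t, 1)) (F (s, 3))"
      and Qm: "Q m \<noteq> Q (m + 1)"
    using exists_consecutive_change[of "min (F (t, 1)) (F (s, 3))" "max (F (t, 1)) (F (s, 3))" Q]
    by (cases "F (t, 1)" "F (s, 3)" rule: linorder_cases) auto
  then have m: "F (r, 2) < m" "m + 1 < F (r + 1, 2)"
    using t1 s3 by (auto simp: min_def max_def split: if_splits)
  have "F (r + 1, 2) \<le> k * 3"
    using filling_range[OF Ff, of "(r + 1, 2)"] r by (simp add: cells)
  then have "1 \<le> m" "m \<le> k * 3" "1 \<le> m + 1" "m + 1 \<le> k * 3"
    using m by simp_all
  then obtain a i b j where x: "(a, i) \<in> cells k 3" "F (a, i) = m"
    and y: "(b, j) \<in> cells k 3" "F (b, j) = m + 1"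
    using filling_onto[OF Ff] by (metis surj_pair)
  have "i \<in> {1, 3}" "j \<in> {1, 3}"
    using gap[of a i] gap[of b j] x y m by auto
  moreover have "Q m \<longleftrightarrow> i = 1" "Q (m + 1) \<longleftrightarrow> j = 1"
    using ne[OF _ x(1)] ne[OF _ y(1)] x y by (auto simp: Q_def)
  ultimately have "i + 1 < j \<or> j + 1 < i" using Qm by auto
  then have "F \<circ> transpose (a, i) (b, j) \<in> matching_fillings k P 3"
    using x y by (intro swap_in_matching_fillings[OF P F]) auto
  moreover have "(F \<circ> transpose (a, i) (b, j)) (a, i) \<noteq> F (a, i)"
    using x y by simp
  ultimately show ?thesis by metis
qed

theorem theorem13:
  fixes k :: nat and P :: "nat \<times> nat \<Rightarrow> nat"
  assumes "k \<ge> 2"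
    and "P \<in> standard_tableaux2 k"
  shows "(\<forall>n\<ge>1. full k P n = 1) \<longleftrightarrow> degenerate k P"
proof
  have P: "P \<in> fillings 2 k" using assms(2) by (simp add: standard_tableaux2_def)
  {
    assume "\<forall>n\<ge>1. full k P n = 1"
    then have "full k P 3 = 1" by simp
    then have "card (matching_fillings k P 3) = 1"
      by (simp add: full_def matching_fillings_def)
    then obtain F where "matching_fillings k P 3 = {F}"
      by (auto simp: card_1_singleton_iff)
    then show "degenerate k P"
      using not_degenerate_not_unique[OF P, of F] by auto
  next
    assume deg: "degenerate k P"
    show "\<forall>n\<ge>1. full k P n = 1"
    proof (intro allI impI)
      fix n :: nat
      obtain F where F: "F \<in> matching_fillings k P n"
        using matching_fillings_nonempty[OF P] by blast
      have "F = G" if "G \<in> matching_fillings k P n" for G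
        using matching_filling_unique[OF P F that] degenerate_consecutive_near[OF assms(2) deg F]
        by blast
      then have "matching_fillings k P n = {F}" using F by blast
      then have "card (matching_fillings k P n) = 1" by simp
      then show "full k P n = 1" by (simp add: full_def matching_fillings_def)
    qed
  }
qed

end
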